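(* Let $K$ be a field of characteristic $0$, let $\widehat W$ be the completion of the associative algebra $W$ generated by two generic traceless $2\times2$ matrices $x,y$ over $K$, and let $t=\mathrm{tr}(x^2)$, $u=\mathrm{tr}(y^2)$, $v=\mathrm{tr}(xy)$. Let $X=ax+by+c[x,y]$, $a,b,c\in K[[t,u,v]]$, be an element of $\widehat W$ and let $$\mathrm{M}(\mathrm{ad}\,X)=\begin{pmatrix} -2cv & -2cu & 2(av+bu) \\ 2ct & 2cv & -2(at+bv) \\ b & -a & 0 \end{pmatrix}$$ be the associated matrix of $\mathrm{ad}\,X$. Then the associated matrix of $\exp(\mathrm{ad}\,X)$ is of the form $$\mathrm{M}(\exp(\mathrm{ad}\,X))=I_3+A(X)\,\mathrm{M}(\mathrm{ad}\,X)+B(X)\,\mathrm{M}^2(\mathrm{ad}\,X),$$ where $$A(X)=\frac{\sinh(\sqrt{g(X)})}{\sqrt{g(X)}},\qquad B(X)=\frac{\cosh(\sqrt{g(X)})-1}{g(X)},$$ $$g(X)=2\left(a^2t+2abv+b^2u+2c^2(v^2-tu)\right).$$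
   Context: The generic traceless matrices are $x=\begin{pmatrix} x_{11} & x_{12} \\ x_{21} & -x_{11} \end{pmatrix}$, $y=\begin{pmatrix} y_{11} & y_{12} \\ y_{21} & -y_{11} \end{pmatrix}$ with $x_{11},x_{12},x_{21},y_{11},y_{12},y_{21}$ algebraically independent commuting variables; $W$ is the unital $K$-subalgebra of $M_2(K[x_{ij},y_{ij}])$ generated by $x,y$, polynomials being identified with scalar matrices. $W$ is graded by total degree in $x,y$, and $\widehat W$ is its completion in the formal power series topology (elements are formal series $f_0+f_1+\cdots$ with $f_n$ homogeneous of degree $n$). The elements $t,u,v\in W$ are central and algebraically independent, and $\widehat W$ is a free $K[[t,u,v]]$-module with basis $1,x,y,[x,y]$, where $[z_1,z_2]=z_1z_2-z_2z_1$. For $X\in\widehat W$, $\mathrm{ad}\,X$ acts by $z\,\mathrm{ad}\,X=[z,X]$ and $\exp(\mathrm{ad}\,X)=\sum_{n\ge0}\mathrm{ad}^nX/n!$. Both restrict to $K[[t,u,v]]$-module endomorphisms of the free submodule with basis $\{x,y,[x,y]\}$. For an endomorphism $\delta$ of this submodule, the associated matrix $\mathrm{M}(\delta)=(\sigma_{ij})\in M_3(K[[t,u,v]])$ is its matrix in this basis, with columns the coordinates of the images: $\delta(x)=\sigma_{11}x+\sigma_{21}y+\sigma_{31}[x,y]$, $\delta(y)=\sigma_{12}x+\sigma_{22}y+\sigma_{32}[x,y]$, $\delta([x,y])=\sigma_{13}x+\sigma_{23}y+\sigma_{33}[x,y]$. $I_3$ is the $3\times3$ identity matrix. The expressions $A(X),B(X)$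 are formal power series in $g(X)$: $\frac{\sinh\sqrt w}{\sqrt w}=\sum_{n\ge0}\frac{w^n}{(2n+1)!}$, $\frac{\cosh\sqrt w-1}{w}=\sum_{n\ge0}\frac{w^n}{(2n+2)!}$. *)

theory Defs
  imports "HOL-Analysis.Analysis" "HOL-Library.Poly_Mapping"
begin

unbundle no fps_syntax

text \<open>Below, \<open>$\<close> always denotes a vector component.  The product of square matrices
  is \<open>**\<close>; the ring multiplication \<open>*\<close> of the vector type is entrywise and is never used on
  matrices.\<close>

section \<open>The coordinate ring and the generic traceless matrices\<close>

datatype indet = X11 | X12 | X21 | Y11 | Y12 | Y21

type_synonym 'k coord_poly = "(indet \<Rightarrow>\<^sub>0 nat) \<Rightarrow>\<^sub>0 'k"

definition Var :: "indet \<Rightarrow> 'k::comm_ring_1 coord_poly" where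
  "Var i = Poly_Mapping.single (Poly_Mapping.single i 1) 1"

definition Const :: "'k::comm_ring_1 \<Rightarrow> 'k coord_poly" where
  "Const k = Poly_Mapping.single 0 k"

definition monom_degree :: "(indet \<Rightarrow>\<^sub>0 nat) \<Rightarrow> nat" where
  "monom_degree m = (\<Sum>i\<in>Poly_Mapping.keys m. Poly_Mapping.lookup m i)"

definition homogeneous :: "nat \<Rightarrow> 'k::comm_ring_1 coord_poly \<Rightarrow> bool" where
  "homogeneous n p \<longleftrightarrow> (\<forall>m\<in>Poly_Mapping.keys p. monom_degree m = n)"

definition generic_x :: "'k::comm_ring_1 coord_poly^2^2" where
  "generic_x = vector [vector [Var X11, Var X12], vector [Var X21, - Var X11]]"

definition generic_y :: "'k::comm_ring_1 coord_poly^2^2" where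
  "generic_y = vector [vector [Var Y11, Var Y12], vector [Var Y21, - Var Y11]]"

text \<open>Scalars are identified with scalar matrices.\<close>

abbreviation scalar_times :: "'r::semiring_1 \<Rightarrow> 'r^'n^'n \<Rightarrow> 'r^'n^'n" (infixr \<open>\<odot>\<close> 75) where
  "a \<odot> A \<equiv> mat a ** A"

definition commutator :: "'r::ring_1^'n^'n \<Rightarrow> 'r^'n^'n \<Rightarrow> 'r^'n^'n" where
  "commutator A B = A ** B - B ** A"

inductive_set W :: "('k::comm_ring_1 coord_poly^2^2) set" where
  const: "mat (Const k) \<in> W"
| x: "generic_x \<in> W"
| y: "generic_y \<in> W"
| add: "f \<in> W \<Longrightarrow> g \<in> W \<Longrightarrow> f + g \<in> W"
| mult: "f \<in> W \<Longrightarrow> g \<in> W \<Longrightarrow> f ** g \<in> W"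

text \<open>As the entries of both generators are homogeneous of degree one, the total degree in the
  generators is the total degree of the entries.\<close>

definition W_component :: "nat \<Rightarrow> ('k::comm_ring_1 coord_poly^2^2) set" where
  "W_component n = {f \<in> W. \<forall>i j. homogeneous n (f $ i $ j)}"


section \<open>Completion\<close>

text \<open>A formal series \<open>f\<^sub>0 + f\<^sub>1 + \<dots>\<close> with \<open>f\<^sub>n\<close> homogeneous of degree \<open>n\<close> is represented by
  the power series \<open>\<Sum> f\<^sub>n z\<^sup>n\<close> in an auxiliary variable \<open>z\<close> which records the degree.
  Multiplication of such matrices of power series is the multiplication of the completion, and
  the \<open>z\<close>-adic metric of the library is the formal power series topology.\<close>

type_synonym 'k coord_series = "'k coord_poly fps"

definition W_hat :: "('k::comm_ring_1 coord_series^2^2) set" where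
  "W_hat = {F. \<forall>n. (\<chi> i j. fps_nth (F $ i $ j) n) \<in> W_component n}"

definition in_degree :: "nat \<Rightarrow> 'k::comm_ring_1 coord_poly \<Rightarrow> 'k coord_series" where
  "in_degree n p = fps_X ^ n * fps_const p"

definition scal :: "'k::comm_ring_1 \<Rightarrow> 'k coord_series" where
  "scal k = in_degree 0 (Const k)"

definition x_hat :: "'k::comm_ring_1 coord_series^2^2" where
  "x_hat = (\<chi> i j. in_degree 1 (generic_x $ i $ j))"

definition y_hat :: "'k::comm_ring_1 coord_series^2^2" where
  "y_hat = (\<chi> i j. in_degree 1 (generic_y $ i $ j))"

definition t_hat :: "'k::comm_ring_1 coord_series" where
  "t_hat = trace (x_hat ** x_hat)"

definition u_hat :: "'k::comm_ring_1 coord_series" where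
  "u_hat = trace (y_hat ** y_hat)"

definition v_hat :: "'k::comm_ring_1 coord_series" where
  "v_hat = trace (x_hat ** y_hat)"

text \<open>The subring \<open>K[[t,u,v]]\<close>: the series \<open>\<Sum> \<alpha>\<^bsub>ijk\<^esub> t\<^sup>i u\<^sup>j v\<^sup>k\<close>.  The traces \<open>t\<close>, \<open>u\<close>, \<open>v\<close> are
  homogeneous of degree two.\<close>

definition K_tuv :: "'k::comm_ring_1 coord_series set" where
  "K_tuv = {f. \<exists>\<alpha> :: nat \<Rightarrow> nat \<Rightarrow> nat \<Rightarrow> 'k. \<forall>n. fps_nth f n =
     (\<Sum>(i, j, k) | 2 * (i + j + k) = n.
        Const (\<alpha> i j k) * trace (generic_x ** generic_x) ^ i
          * trace (generic_y ** generic_y) ^ j * trace (generic_x ** generic_y) ^ k)}"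


section \<open>The adjoint action and associated matrices\<close>

definition ad :: "'k::comm_ring_1 coord_series^2^2 \<Rightarrow> 'k coord_series^2^2 \<Rightarrow> 'k coord_series^2^2" where
  "ad X z = commutator z X"

definition exp_ad ::
    "'k::field_char_0 coord_series^2^2 \<Rightarrow> 'k coord_series^2^2 \<Rightarrow> 'k coord_series^2^2" where
  "exp_ad X z = suminf (\<lambda>n. scal (1 / fact n) \<odot> (ad X ^^ n) z)"

definition combination ::
    "'k::comm_ring_1 coord_series \<Rightarrow> 'k coord_series \<Rightarrow> 'k coord_series \<Rightarrow> 'k coord_series^2^2" where
  "combination p q r = p \<odot> x_hat + q \<odot> y_hat + r \<odot> commutator x_hat y_hat"

definition has_associated_matrix ::
    "('k::comm_ring_1 coord_series^2^2 \<Rightarrow> 'k coord_series^2^2) \<Rightarrow> 'k coord_series^3^3 \<Rightarrow> bool" where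
  "has_associated_matrix \<delta> \<sigma> \<longleftrightarrow>
     (\<forall>i j. \<sigma> $ i $ j \<in> K_tuv) \<and>
     \<delta> x_hat = combination (\<sigma> $ 1 $ 1) (\<sigma> $ 2 $ 1) (\<sigma> $ 3 $ 1) \<and>
     \<delta> y_hat = combination (\<sigma> $ 1 $ 2) (\<sigma> $ 2 $ 2) (\<sigma> $ 3 $ 2) \<and>
     \<delta> (commutator x_hat y_hat) = combination (\<sigma> $ 1 $ 3) (\<sigma> $ 2 $ 3) (\<sigma> $ 3 $ 3)"

text \<open>\<open>sinh \<surd>w / \<surd>w\<close> and \<open>(cosh \<surd>w - 1) / w\<close>\<close>

definition sinh_series :: "'k::field_char_0 coord_series \<Rightarrow> 'k coord_series" where
  "sinh_series w = suminf (\<lambda>n. scal (1 / fact (2 * n + 1)) * w ^ n)"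

definition cosh_series :: "'k::field_char_0 coord_series \<Rightarrow> 'k coord_series" where
  "cosh_series w = suminf (\<lambda>n. scal (1 / fact (2 * n + 2)) * w ^ n)"


section \<open>The notions are well behaved\<close>

subsection \<open>Uniqueness of the associated matrix\<close>

text \<open>The linear order only serves to make the coordinate ring an integral domain.\<close>

instantiation indet :: linorder
begin

definition indet_rank :: "indet \<Rightarrow> nat" where
  "indet_rank i = (case i of X11 \<Rightarrow> 0 | X12 \<Rightarrow> 1 | X21 \<Rightarrow> 2 | Y11 \<Rightarrow> 3 | Y12 \<Rightarrow> 4 | Y21 \<Rightarrow> 5)"

definition less_eq_indet :: "indet \<Rightarrow> indet \<Rightarrow> bool" where
  "less_eq_indet i j \<longleftrightarrow> indet_rank i \<le> indet_rank j"

definition less_indet :: "indet \<Rightarrow> indet \<Rightarrow> bool" where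
  "less_indet i j \<longleftrightarrow> indet_rank i < indet_rank j"

instance
  by standard
    (auto simp: less_eq_indet_def less_indet_def indet_rank_def split: indet.splits)

end

lemma det_nonzero:
  fixes x1 x2 x3 y1 y2 y3 :: "'k::field_char_0 coord_poly"
  defines "x1 \<equiv> Var X11" and "x2 \<equiv> Var X12" and "x3 \<equiv> Var X21"
    and "y1 \<equiv> Var Y11" and "y2 \<equiv> Var Y12" and "y3 \<equiv> Var Y21"
  shows "(x2 * y3 - x3 * y2)\<^sup>2 + 4 * (x1 * y2 - x2 * y1) * (x3 * y1 - x1 * y3) \<noteq> 0"
    (is "?D \<noteq> 0")
proof -
  define m where "m = Poly_Mapping.single X12 (2::nat) + Poly_Mapping.single Y21 2"
  have var: "Var i * Var j * Var k * Var l =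
      (Poly_Mapping.single (Poly_Mapping.single i 1 + Poly_Mapping.single j 1
        + Poly_Mapping.single k 1 + Poly_Mapping.single l 1) 1 :: 'k coord_poly)" for i j k l
    by (simp add: Var_def mult_single)
  have look: "Poly_Mapping.lookup (Var i * Var j * Var k * Var l :: 'k coord_poly) m =
      (if Poly_Mapping.single i 1 + Poly_Mapping.single j 1
        + Poly_Mapping.single k 1 + Poly_Mapping.single l 1 = m then 1 else 0)" for i j k l
    unfolding var lookup_single when_def by (rule refl)
  have neq: "Poly_Mapping.single i 1 + Poly_Mapping.single j 1
        + Poly_Mapping.single k 1 + Poly_Mapping.single l 1 \<noteq> m"
    if "i \<notin> {X12, Y21}" for i j k l
  proof
    assume "Poly_Mapping.single i 1 + Poly_Mapping.single j 1
        + Poly_Mapping.single k 1 + Poly_Mapping.single l 1 = m"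
    then have "Poly_Mapping.lookup (Poly_Mapping.single i (1::nat) + Poly_Mapping.single j 1
        + Poly_Mapping.single k 1 + Poly_Mapping.single l 1) i = Poly_Mapping.lookup m i"
      by simp
    with that show False
      by (auto simp: m_def lookup_add lookup_single when_def)
  qed
  have look0: "Poly_Mapping.lookup (Var i * Var j * Var k * Var l :: 'k coord_poly) m = 0"
    if "i \<notin> {X12, Y21}" for i j k l
    using neq[OF that] look by presburger
  have eq: "?D = x2 * x2 * y3 * y3
      + (- (x3*y2*x2*y3) - x3*y2*x2*y3 + x3*y2*x3*y2
      + (x1*y2*x3*y1 + x1*y2*x3*y1 + x1*y2*x3*y1 + x1*y2*x3*y1)
      - (x1*y2*x1*y3 + x1*y2*x1*y3 + x1*y2*x1*y3 + x1*y2*x1*y3)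
      - (x3*x2*y1*y1 + x3*x2*y1*y1 + x3*x2*y1*y1 + x3*x2*y1*y1)
      + (x1*x2*y1*y3 + x1*x2*y1*y3 + x1*x2*y1*y3 + x1*x2*y1*y3))"
    by algebra
  have "Poly_Mapping.lookup (x2 * x2 * y3 * y3) m = 1"
    unfolding x2_def y3_def look
    by (simp add: m_def add.assoc numeral_2_eq_2 flip: single_add)
  then have "Poly_Mapping.lookup ?D m = 1"
    unfolding eq unfolding lookup_add lookup_minus lookup_uminus
    unfolding x1_def x2_def x3_def y1_def y2_def y3_def
    by (simp add: look0)
  then show ?thesis by auto
qed

lemma fps_det_nonzero:
  fixes x1 x2 x3 y1 y2 y3 :: "'k::field_char_0 coord_series"
  defines "x1 \<equiv> in_degree 1 (Var X11)" and "x2 \<equiv> in_degree 1 (Var X12)"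
    and "x3 \<equiv> in_degree 1 (Var X21)" and "y1 \<equiv> in_degree 1 (Var Y11)"
    and "y2 \<equiv> in_degree 1 (Var Y12)" and "y3 \<equiv> in_degree 1 (Var Y21)"
  shows "(x2 * y3 - x3 * y2)\<^sup>2 + 4 * (x1 * y2 - x2 * y1) * (x3 * y1 - x1 * y3) \<noteq> 0"
    (is "?D \<noteq> 0")
proof -
  define D :: "'k coord_poly" where "D = (Var X12 * Var Y21 - Var X21 * Var Y12)\<^sup>2 +
      4 * (Var X11 * Var Y12 - Var X12 * Var Y11) * (Var X21 * Var Y11 - Var X11 * Var Y21)"
  have D: "fps_const D = (fps_const (Var X12) * fps_const (Var Y21)
        - fps_const (Var X21) * fps_const (Var Y12))\<^sup>2 +
      4 * (fps_const (Var X11) * fps_const (Var Y12) - fps_const (Var X12) * fps_const (Var Y11))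
        * (fps_const (Var X21) * fps_const (Var Y11) - fps_const (Var X11) * fps_const (Var Y21))"
    by (simp add: D_def fps_numeral_fps_const power2_eq_square)
  have "?D = fps_X ^ 4 * fps_const D"
    unfolding x1_def x2_def x3_def y1_def y2_def y3_def in_degree_def D by algebra
  moreover have "fps_const D \<noteq> 0"
    using det_nonzero by (simp add: D_def)
  ultimately show ?thesis by simp
qed

lemma cramer3:
  fixes x1 x2 x3 y1 y2 y3 p q r :: "'r::idom"
  assumes "(x2 * y3 - x3 * y2)\<^sup>2 + 4 * (x1 * y2 - x2 * y1) * (x3 * y1 - x1 * y3) \<noteq> 0"
    and "p * x1 + q * y1 + r * (x2 * y3 - x3 * y2) = 0"
    and "p * x2 + q * y2 + r * (2 * (x1 * y2 - x2 * y1)) = 0"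
    and "p * x3 + q * y3 + r * (2 * (x3 * y1 - x1 * y3)) = 0"
  shows "p = 0" "q = 0" "r = 0"
proof -
  let ?D = "(x2 * y3 - x3 * y2)\<^sup>2 + 4 * (x1 * y2 - x2 * y1) * (x3 * y1 - x1 * y3)"
  have "p * ?D = 0" "q * ?D = 0" "r * ?D = 0"
    using assms(2-4) by algebra+
  with assms(1) show "p = 0" "q = 0" "r = 0" by simp_all
qed

lemma combination_entries:
  fixes x1 x2 x3 y1 y2 y3 :: "'k::field_char_0 coord_series"
  defines "x1 \<equiv> in_degree 1 (Var X11)" and "x2 \<equiv> in_degree 1 (Var X12)"
    and "x3 \<equiv> in_degree 1 (Var X21)" and "y1 \<equiv> in_degree 1 (Var Y11)"
    and "y2 \<equiv> in_degree 1 (Var Y12)" and "y3 \<equiv> in_degree 1 (Var Y21)"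
  shows "combination p q r $ 1 $ 1 = p * x1 + q * y1 + r * (x2 * y3 - x3 * y2)"
    and "combination p q r $ 1 $ 2 = p * x2 + q * y2 + r * (2 * (x1 * y2 - x2 * y1))"
    and "combination p q r $ 2 $ 1 = p * x3 + q * y3 + r * (2 * (x3 * y1 - x1 * y3))"
proof -
  have neg: "in_degree n (- f) = - in_degree n f" for n and f :: "'k coord_poly"
    by (simp add: in_degree_def flip: fps_const_neg)
  show "combination p q r $ 1 $ 1 = p * x1 + q * y1 + r * (x2 * y3 - x3 * y2)"
    and "combination p q r $ 1 $ 2 = p * x2 + q * y2 + r * (2 * (x1 * y2 - x2 * y1))"
    and "combination p q r $ 2 $ 1 = p * x3 + q * y3 + r * (2 * (x3 * y1 - x1 * y3))"
    unfolding x1_def x2_def x3_def y1_def y2_def y3_def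
    by (simp_all add: combination_def commutator_def matrix_matrix_mult_def mat_def sum_2
        x_hat_def y_hat_def generic_x_def generic_y_def neg algebra_simps)
qed

lemma combination_inj:
  fixes p q r :: "'k::field_char_0 coord_series"
  assumes "combination p q r = combination p' q' r'"
  shows "p = p' \<and> q = q' \<and> r = r'"
proof -
  have diff: "combination (p - p') (q - q') (r - r') $ i $ j
      = combination p q r $ i $ j - combination p' q' r' $ i $ j" if "(i, j) \<in> {(1,1),(1,2),(2,1)}" for i j
    using that by (auto simp: combination_entries algebra_simps)
  have 0: "combination (p - p') (q - q') (r - r') $ 1 $ 1 = 0"
    "combination (p - p') (q - q') (r - r') $ 1 $ 2 = 0"
    "combination (p - p') (q - q') (r - r') $ 2 $ 1 = 0"
    using assms by (simp_all add: diff)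
  show ?thesis
    using cramer3[OF fps_det_nonzero 0[unfolded combination_entries]] by simp
qed

lemma has_associated_matrix_unique:
  fixes \<sigma> \<tau> :: "'k::field_char_0 coord_series^3^3"
  assumes "has_associated_matrix \<delta> \<sigma>" and "has_associated_matrix \<delta> \<tau>"
  shows "\<sigma> = \<tau>"
proof -
  have "combination (\<sigma> $ 1 $ j) (\<sigma> $ 2 $ j) (\<sigma> $ 3 $ j) = combination (\<tau> $ 1 $ j) (\<tau> $ 2 $ j) (\<tau> $ 3 $ j)"
    for j
    using exhaust_3[of j] assms unfolding has_associated_matrix_def by (elim disjE) simp_all
  then have "\<sigma> $ 1 $ j = \<tau> $ 1 $ j \<and> \<sigma> $ 2 $ j = \<tau> $ 2 $ j \<and> \<sigma> $ 3 $ j = \<tau> $ 3 $ j" for j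
    by (rule combination_inj)
  then show ?thesis unfolding vec_eq_iff by (simp only: forall_3 simp_thms)
qed

subsection \<open>Elements with coordinates in \<open>K[[t,u,v]]\<close> lie in the completion\<close>

lemma monom_degree_add: "monom_degree (m + n) = monom_degree m + monom_degree n"
proof -
  have fin: "finite (UNIV :: indet set)"
    by (rule finite_subset[of _ "{X11, X12, X21, Y11, Y12, Y21}"]) (use indet.exhaust in auto)
  have "monom_degree k = (\<Sum>i\<in>UNIV. Poly_Mapping.lookup k i)" for k
    unfolding monom_degree_def
    by (rule sum.mono_neutral_left[OF fin]) (auto simp: in_keys_iff)
  then show ?thesis by (simp add: lookup_add sum.distrib)
qed

lemma homogeneous_0 [simp]: "homogeneous n 0"
  by (simp add: homogeneous_def)

lemma homogeneous_Const [simp]: "homogeneous 0 (Const k)"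
  by (auto simp: homogeneous_def Const_def monom_degree_def)

lemma homogeneous_Var [simp]: "homogeneous (Suc 0) (Var i)"
  by (simp add: homogeneous_def Var_def monom_degree_def)

lemma homogeneous_uminus [simp]: "homogeneous n (- p) \<longleftrightarrow> homogeneous n p"
  by (simp add: homogeneous_def)

lemma homogeneous_add: "homogeneous n p \<Longrightarrow> homogeneous n q \<Longrightarrow> homogeneous n (p + q)"
  unfolding homogeneous_def using keys_add[of p q] by blast

lemma homogeneous_mult:
  "homogeneous m p \<Longrightarrow> homogeneous n q \<Longrightarrow> homogeneous (m + n) (p * q)"
  unfolding homogeneous_def using keys_mult[of p q] by (fastforce simp: monom_degree_add)

lemma Const_0 [simp]: "Const 0 = 0" and Const_1: "Const 1 = 1"
  by (simp_all add: Const_def single_one)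

lemma W_component_zero: "0 \<in> W_component n"
  using W.const[of 0] by (simp add: W_component_def)

lemma W_component_const: "mat (Const k) \<in> W_component 0"
  using W.const by (auto simp: W_component_def mat_def)

lemma W_component_x: "generic_x \<in> W_component (Suc 0)"
  and W_component_y: "generic_y \<in> W_component (Suc 0)"
  using W.x W.y by (auto simp: W_component_def forall_2 generic_x_def generic_y_def)

lemma W_component_add:
  "f \<in> W_component n \<Longrightarrow> g \<in> W_component n \<Longrightarrow> f + g \<in> W_component n"
  by (auto simp: W_component_def intro: W.add homogeneous_add)

lemma W_component_mult:
  "f \<in> W_component m \<Longrightarrow> g \<in> W_component n \<Longrightarrow> f ** g \<in> W_component (m + n)"
  unfolding W_component_def
  by (simp add: W.mult) (simp add: matrix_matrix_mult_def sum_2 homogeneous_add homogeneous_mult)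

lemma W_component_scale: "f \<in> W_component n \<Longrightarrow> Const k \<odot> f \<in> W_component n"
  using W_component_mult[OF W_component_const, of f n k] by simp

lemma W_component_diff:
  assumes "f \<in> W_component n" "g \<in> W_component n"
  shows "f - g \<in> W_component n"
proof -
  have "Const (-1) = (-1 :: 'a coord_poly)"
    by (simp add: Const_def single_uminus single_one)
  then have "f - g = f + Const (-1) \<odot> g"
    by (simp add: vec_eq_iff matrix_matrix_mult_def mat_def sum_2 if_distrib cong: if_cong)
       (simp add: forall_2)
  with assms show ?thesis by (metis W_component_add W_component_scale)
qed

lemma W_component_sum:
  "(\<And>s. s \<in> S \<Longrightarrow> f s \<in> W_component n) \<Longrightarrow> sum f S \<in> W_component n"
  by (induction S rule: infinite_finite_induct) (auto simp: W_component_zero W_component_add)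

lemma mat_mult: "mat (p * q) = (mat p ** mat q :: 'r::semiring_1^2^2)"
  by (simp add: vec_eq_iff forall_2 matrix_matrix_mult_def mat_def sum_2)

lemma mat_add: "mat (p + q) = (mat p + mat q :: 'r::semiring_1^2^2)"
  by (simp add: vec_eq_iff mat_def)

lemma mat_sum: "mat (sum f S) = (\<Sum>s\<in>S. mat (f s) :: 'r::semiring_1^2^2)"
proof (induction S rule: infinite_finite_induct)
  case (insert s S)
  then show ?case by (simp add: mat_add)
qed (simp_all add: vec_eq_iff mat_def)

lemma W_component_power: "mat p \<in> W_component n \<Longrightarrow> mat (p ^ i) \<in> W_component (i * n)"
proof (induction i)
  case 0
  show ?case using W_component_const[of 1] by (simp add: Const_1)
next
  case (Suc i)
  then show ?case using W_component_mult[of "mat p" n "mat (p ^ i)"] by (simp add: mat_mult)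
qed

lemma W_component_xx: "generic_x ** generic_x \<in> W_component 2"
  and W_component_yy: "generic_y ** generic_y \<in> W_component 2"
  and W_component_xy: "generic_x ** generic_y \<in> W_component 2"
  and W_component_yx: "generic_y ** generic_x \<in> W_component 2"
  unfolding numeral_2_eq_2
  using W_component_mult[OF W_component_x W_component_x]
    W_component_mult[OF W_component_y W_component_y]
    W_component_mult[OF W_component_x W_component_y]
    W_component_mult[OF W_component_y W_component_x] by simp_all

lemma W_component_t: "mat (trace (generic_x ** generic_x)) \<in> W_component 2"
proof -
  have "mat (trace (generic_x ** generic_x)) =
      generic_x ** generic_x + (generic_x ** generic_x :: 'a coord_poly^2^2)"
    by (simp add: vec_eq_iff forall_2 trace_def matrix_matrix_mult_def mat_def sum_2 generic_x_def)
  then show ?thesis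
    using W_component_add[OF W_component_xx W_component_xx] by metis
qed

lemma W_component_u: "mat (trace (generic_y ** generic_y)) \<in> W_component 2"
proof -
  have "mat (trace (generic_y ** generic_y)) =
      generic_y ** generic_y + (generic_y ** generic_y :: 'a coord_poly^2^2)"
    by (simp add: vec_eq_iff forall_2 trace_def matrix_matrix_mult_def mat_def sum_2 generic_y_def)
  then show ?thesis
    using W_component_add[OF W_component_yy W_component_yy] by metis
qed

lemma W_component_v: "mat (trace (generic_x ** generic_y)) \<in> W_component 2"
proof -
  have "mat (trace (generic_x ** generic_y)) =
      generic_x ** generic_y + (generic_y ** generic_x :: 'a coord_poly^2^2)"
    by (simp add: vec_eq_iff forall_2 trace_def matrix_matrix_mult_def mat_def sum_2
        generic_x_def generic_y_def)
  then show ?thesis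
    using W_component_add[OF W_component_xy W_component_yx] by metis
qed

lemma K_tuv_in_W_hat:
  assumes "f \<in> K_tuv"
  shows "mat f \<in> W_hat"
proof -
  have mat_nth: "(\<chi> i j. fps_nth ((mat f :: _^2^2) $ i $ j) n) = mat (fps_nth f n)" for n
    by (simp add: vec_eq_iff mat_def)
  have "mat (fps_nth f n) \<in> W_component n" for n
  proof -
    obtain \<alpha> :: "nat \<Rightarrow> nat \<Rightarrow> nat \<Rightarrow> 'a" where \<alpha>: "fps_nth f n =
      (\<Sum>(i, j, k) | 2 * (i + j + k) = n.
        Const (\<alpha> i j k) * trace (generic_x ** generic_x) ^ i
          * trace (generic_y ** generic_y) ^ j * trace (generic_x ** generic_y) ^ k)"
      using assms unfolding K_tuv_def by blast
    have *: "mat (Const (\<alpha> i j k) * trace (generic_x ** generic_x) ^ i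
          * trace (generic_y ** generic_y) ^ j * trace (generic_x ** generic_y) ^ k)
        \<in> W_component (0 + i * 2 + j * 2 + k * 2)" for i j k
      unfolding mat_mult
      by (intro W_component_mult W_component_const W_component_power
          W_component_t W_component_u W_component_v)
    have "mat (Const (\<alpha> i j k) * trace (generic_x ** generic_x) ^ i
          * trace (generic_y ** generic_y) ^ j * trace (generic_x ** generic_y) ^ k)
        \<in> W_component n" if "2 * (i + j + k) = n" for i j k
    proof -
      have "0 + i * 2 + j * 2 + k * 2 = n"
        using that by simp
      with * show ?thesis by metis
    qed
    then show ?thesis
      unfolding \<alpha> mat_sum by (intro W_component_sum) auto
  qed
  then show ?thesis by (simp add: W_hat_def mat_nth)
qed

lemma W_hat_add: "F \<in> W_hat \<Longrightarrow> G \<in> W_hat \<Longrightarrow> F + G \<in> W_hat"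
  and W_hat_diff: "F \<in> W_hat \<Longrightarrow> G \<in> W_hat \<Longrightarrow> F - G \<in> W_hat"
proof -
  assume *: "F \<in> W_hat" "G \<in> W_hat"
  have "(\<chi> i j. fps_nth ((F + G) $ i $ j) n)
      = (\<chi> i j. fps_nth (F $ i $ j) n) + (\<chi> i j. fps_nth (G $ i $ j) n)"
    "(\<chi> i j. fps_nth ((F - G) $ i $ j) n)
      = (\<chi> i j. fps_nth (F $ i $ j) n) - (\<chi> i j. fps_nth (G $ i $ j) n)" for n
    by (simp_all add: vec_eq_iff)
  with * show "F + G \<in> W_hat" "F - G \<in> W_hat"
    by (simp_all add: W_hat_def W_component_add W_component_diff)
qed

lemma W_hat_mult:
  assumes "F \<in> W_hat" "G \<in> W_hat"
  shows "F ** G \<in> W_hat"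
proof -
  let ?c = "\<lambda>F n. (\<chi> i j. fps_nth (F $ i $ j) n) :: 'a coord_poly^2^2"
  have eq: "?c (F ** G) n = (\<Sum>i=0..n. ?c F i ** ?c G (n - i))" for n
    by (simp add: vec_eq_iff matrix_matrix_mult_def sum_2 fps_mult_nth sum.distrib)
  have "?c F i ** ?c G (n - i) \<in> W_component n" if "i \<le> n" for i n
    using W_component_mult[of "?c F i" i "?c G (n - i)" "n - i"] assms that
    by (simp add: W_hat_def)
  then have "?c (F ** G) n \<in> W_component n" for n
    unfolding eq by (intro W_component_sum) auto
  then show ?thesis by (simp add: W_hat_def)
qed

lemma x_hat_in_W_hat: "x_hat \<in> (W_hat :: ('a::comm_ring_1 coord_series^2^2) set)"
  and y_hat_in_W_hat: "y_hat \<in> (W_hat :: ('a coord_series^2^2) set)"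
proof -
  have "(\<chi> i j. fps_nth ((x_hat :: 'a coord_series^2^2) $ i $ j) n)
      = (if n = Suc 0 then generic_x else 0)"
    "(\<chi> i j. fps_nth ((y_hat :: 'a coord_series^2^2) $ i $ j) n)
      = (if n = Suc 0 then generic_y else 0)" for n
    by (simp_all add: vec_eq_iff x_hat_def y_hat_def in_degree_def)
  then show "x_hat \<in> (W_hat :: ('a coord_series^2^2) set)" "y_hat \<in> (W_hat :: ('a coord_series^2^2) set)"
    using W_component_x W_component_y W_component_zero by (auto simp: W_hat_def)
qed

lemma combination_in_W_hat:
  "a \<in> K_tuv \<Longrightarrow> b \<in> K_tuv \<Longrightarrow> c \<in> K_tuv \<Longrightarrow> combination a b c \<in> W_hat"
  unfolding combination_def commutator_def
  by (intro W_hat_add W_hat_diff W_hat_mult K_tuv_in_W_hat x_hat_in_W_hat y_hat_in_W_hat)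

end

theory Submission
  imports Defs
begin

text \<open>The reason for the formula is that \<open>ad X\<close> satisfies \<open>(ad X)\<^sup>3 = g \<cdot> ad X\<close> with a scalar \<open>g\<close>.
  Indeed \<open>X\<close> is a traceless \<open>2 \<times> 2\<close> matrix, so by Cayley-Hamilton \<open>X\<^sup>2 = h\<close> is a scalar with
  \<open>2 h = trace (X\<^sup>2)\<close>, and expanding the triple commutator,
  \<open>[[[z, X], X], X] = z X\<^sup>3 - 3 X z X\<^sup>2 + 3 X\<^sup>2 z X - X\<^sup>3 z = 4 h [z, X]\<close>
  for every matrix \<open>z\<close>; see \<open>ad_cubed\<close>.  By \<open>trace_combination_squared\<close>, \<open>4 h\<close> is exactly \<open>g\<close>.
  Therefore the odd powers of \<open>ad X\<close> are \<open>g\<^sup>k ad X\<close> and the positive even ones are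
  \<open>g\<^sup>k (ad X)\<^sup>2\<close>, and separating the exponential series by parity gives
  \<open>exp (ad X) = id + A(g) ad X + B(g) (ad X)\<^sup>2\<close> as an operator on all matrices (\<open>exp_ad_eq\<close>).

  The identity of operators becomes one of associated matrices because passing to associated
  matrices respects sums, multiples by \<open>K[[t,u,v]]\<close> and composition.  The matrix of \<open>ad X\<close> itself
  comes from the single relation \<open>[P, [P, Q]] = 2 tr(P\<^sup>2) Q - 2 tr(P Q) P\<close> for traceless \<open>P, Q\<close>
  (\<open>commutator_commutator\<close>), used for \<open>(x, y)\<close> and \<open>(y, x)\<close>.

  Two analytic points remain.  All series converge because \<open>g\<close> has no constant term in the degree
  variable, so that its \<open>k\<close>-th power starts in degree \<open>k\<close> at the earliest.  Their sums stay in
  \<open>K[[t,u,v]]\<close> because membership in that ring can be tested one degree at a time, and each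
  coefficient of such a sum is already the coefficient of a partial sum.\<close>

section \<open>The ring of power series in the traces\<close>

definition trace_monomial :: "'k::comm_ring_1 \<Rightarrow> nat \<Rightarrow> nat \<Rightarrow> nat \<Rightarrow> 'k coord_poly" where
  "trace_monomial c i j k = Const c * trace (generic_x ** generic_x) ^ i
     * trace (generic_y ** generic_y) ^ j * trace (generic_x ** generic_y) ^ k"

definition tuv_component :: "nat \<Rightarrow> 'k::comm_ring_1 coord_poly set" where
  "tuv_component n = {p. \<exists>\<alpha>. p = (\<Sum>(i, j, k) | 2 * (i + j + k) = n. trace_monomial (\<alpha> i j k) i j k)}"

text \<open>The coefficients \<open>\<alpha>\<close> may be chosen in each degree separately: as \<open>t\<close>, \<open>u\<close>, \<open>v\<close> all have degree
  two, a triple of exponents occurs in one degree only, so choices in different degrees never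
  conflict.  This reduces all closure properties of the ring to single degrees.\<close>

lemma K_tuv_iff: "f \<in> K_tuv \<longleftrightarrow> (\<forall>n. fps_nth f n \<in> tuv_component n)"
proof
  assume "f \<in> K_tuv"
  then show "\<forall>n. fps_nth f n \<in> tuv_component n"
    unfolding K_tuv_def tuv_component_def trace_monomial_def by blast
next
  assume "\<forall>n. fps_nth f n \<in> tuv_component n"
  then have "\<forall>n. \<exists>\<alpha>. fps_nth f n =
      (\<Sum>(i, j, k) | 2 * (i + j + k) = n. trace_monomial (\<alpha> i j k) i j k)"
    by (simp add: tuv_component_def)
  from choice[OF this] obtain \<alpha> where \<alpha>: "\<And>n. fps_nth f n =
      (\<Sum>(i, j, k) | 2 * (i + j + k) = n. trace_monomial (\<alpha> n i j k) i j k)"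
    by blast
  have "\<forall>n. fps_nth f n = (\<Sum>(i, j, k) | 2 * (i + j + k) = n.
      trace_monomial (\<alpha> (2 * (i + j + k)) i j k) i j k)"
    unfolding \<alpha> by (intro allI sum.cong) auto
  then show "f \<in> K_tuv"
    unfolding K_tuv_def trace_monomial_def
    by (intro CollectI exI[of _ "\<lambda>i j k. \<alpha> (2 * (i + j + k)) i j k"])
qed

lemma finite_degree_triples: "finite {(i, j, k). 2 * (i + j + k) = (n::nat)}"
  by (rule finite_subset[of _ "{..n} \<times> {..n} \<times> {..n}"]) auto

lemma Const_add: "Const (a + b) = Const a + Const b"
  and Const_mult: "Const (a * b) = Const a * Const b"
  by (simp_all add: Const_def single_add mult_single)

lemma trace_monomial_0 [simp]: "trace_monomial 0 i j k = 0"
  by (simp add: trace_monomial_def)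

lemma trace_monomial_in_component:
  assumes "2 * (i + j + k) = n"
  shows "trace_monomial c i j k \<in> tuv_component n"
proof -
  let ?\<alpha> = "\<lambda>i' j' k'. if (i', j', k') = (i, j, k) then c else 0"
  have "(\<Sum>(i', j', k') | 2 * (i' + j' + k') = n. trace_monomial (?\<alpha> i' j' k') i' j' k')
      = (\<Sum>s | s \<in> {(i, j, k). 2 * (i + j + k) = n}.
           if s = (i, j, k) then trace_monomial c i j k else 0)"
    by (rule sum.cong) (auto split: if_splits)
  also have "\<dots> = trace_monomial c i j k"
    using assms finite_degree_triples[of n] by (subst sum.delta) auto
  finally show ?thesis
    unfolding tuv_component_def by (intro CollectI exI[of _ ?\<alpha>]) simp
qed

lemma tuv_component_0: "0 \<in> tuv_component n"
  unfolding tuv_component_def by (intro CollectI exI[of _ "\<lambda>_ _ _. 0"]) simp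

lemma tuv_component_add:
  assumes "p \<in> tuv_component n" "q \<in> tuv_component n"
  shows "p + q \<in> tuv_component n"
proof -
  from assms obtain \<alpha> \<beta> where
    "p = (\<Sum>(i, j, k) | 2 * (i + j + k) = n. trace_monomial (\<alpha> i j k) i j k)"
    "q = (\<Sum>(i, j, k) | 2 * (i + j + k) = n. trace_monomial (\<beta> i j k) i j k)"
    by (auto simp: tuv_component_def)
  then have "p + q = (\<Sum>(i, j, k) | 2 * (i + j + k) = n.
      trace_monomial (\<alpha> i j k + \<beta> i j k) i j k)"
    by (simp add: case_prod_unfold trace_monomial_def Const_add algebra_simps flip: sum.distrib)
  then show ?thesis
    unfolding tuv_component_def by (intro CollectI exI[of _ "\<lambda>i j k. \<alpha> i j k + \<beta> i j k"])
qed

lemma tuv_component_sum: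
  "(\<And>s. s \<in> S \<Longrightarrow> f s \<in> tuv_component n) \<Longrightarrow> sum f S \<in> tuv_component n"
  by (induction S rule: infinite_finite_induct) (auto simp: tuv_component_0 tuv_component_add)

lemma tuv_component_mult:
  assumes "p \<in> tuv_component m" "q \<in> tuv_component n"
  shows "p * q \<in> tuv_component (m + n)"
proof -
  from assms obtain \<alpha> \<beta> where
    p: "p = (\<Sum>(i, j, k) | 2 * (i + j + k) = m. trace_monomial (\<alpha> i j k) i j k)" and
    q: "q = (\<Sum>(i, j, k) | 2 * (i + j + k) = n. trace_monomial (\<beta> i j k) i j k)"
    by (auto simp: tuv_component_def)
  have "trace_monomial c i j k * trace_monomial d i' j' k'
      = trace_monomial (c * d) (i + i') (j + j') (k + k')" for c d :: 'a and i j k i' j' k'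
    by (simp add: trace_monomial_def Const_mult power_add algebra_simps)
  then have summand: "trace_monomial c i j k * trace_monomial d i' j' k' \<in> tuv_component (m + n)"
    if "2 * (i + j + k) = m" "2 * (i' + j' + k') = n" for c d :: 'a and i j k i' j' k'
    using that by (simp add: trace_monomial_in_component)
  show ?thesis
    unfolding p q sum_product
    by (intro tuv_component_sum) (simp add: case_prod_unfold summand)
qed

lemma K_tuv_0: "0 \<in> K_tuv"
  by (simp add: K_tuv_iff tuv_component_0)

lemma K_tuv_add: "f \<in> K_tuv \<Longrightarrow> h \<in> K_tuv \<Longrightarrow> f + h \<in> K_tuv"
  by (simp add: K_tuv_iff tuv_component_add)

lemma K_tuv_sum: "(\<And>s. s \<in> S \<Longrightarrow> f s \<in> K_tuv) \<Longrightarrow> sum f S \<in> K_tuv"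
  by (induction S rule: infinite_finite_induct) (auto simp: K_tuv_0 K_tuv_add)

lemma K_tuv_mult: "f \<in> K_tuv \<Longrightarrow> h \<in> K_tuv \<Longrightarrow> f * h \<in> K_tuv"
  unfolding K_tuv_iff fps_mult_nth
proof (intro allI tuv_component_sum)
  fix n i :: nat
  assume "\<forall>n. fps_nth f n \<in> tuv_component n" "\<forall>n. fps_nth h n \<in> tuv_component n" "i \<in> {0..n}"
  then show "fps_nth f i * fps_nth h (n - i) \<in> tuv_component n"
    using tuv_component_mult[of "fps_nth f i" i "fps_nth h (n - i)" "n - i"] by simp
qed

lemma in_degree_in_K_tuv: "p \<in> tuv_component n \<Longrightarrow> in_degree n p \<in> K_tuv"
  by (simp add: K_tuv_iff in_degree_def fps_X_power_mult_nth fps_eq_iff tuv_component_0)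

lemma scal_in_K_tuv: "scal c \<in> K_tuv"
  unfolding scal_def
  by (rule in_degree_in_K_tuv) (use trace_monomial_in_component[of 0 0 0 0 c] in \<open>simp add: trace_monomial_def\<close>)

lemma scal_1: "scal 1 = 1"
  by (simp add: scal_def in_degree_def Const_1)

lemma scal_minus_1: "scal (- 1) = - 1"
  by (simp add: scal_def in_degree_def Const_def single_uminus single_one flip: fps_const_neg)

lemma K_tuv_1: "1 \<in> K_tuv"
  using scal_in_K_tuv[of 1] by (simp add: scal_1)

lemma K_tuv_uminus: "f \<in> K_tuv \<Longrightarrow> - f \<in> K_tuv"
  using K_tuv_mult[OF scal_in_K_tuv[of "- 1"], of f] by (simp add: scal_minus_1)

lemma K_tuv_diff: "f \<in> K_tuv \<Longrightarrow> h \<in> K_tuv \<Longrightarrow> f - h \<in> K_tuv"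
  using K_tuv_add[OF _ K_tuv_uminus, of f h] by simp

lemma K_tuv_power: "f \<in> K_tuv \<Longrightarrow> f ^ n \<in> K_tuv"
  by (induction n) (auto simp: K_tuv_1 K_tuv_mult)

lemma K_tuv_2: "2 \<in> K_tuv"
  using K_tuv_add[OF K_tuv_1 K_tuv_1] by simp

text \<open>The degree variable in the entries of \<open>x_hat\<close> and \<open>y_hat\<close> collects into a factor in front of the
  trace; this shows both that the traces are series in themselves and that they have no constant
  term.\<close>

lemma trace_hat:
  "t_hat = in_degree 2 (trace (generic_x ** generic_x :: 'a::comm_ring_1 coord_poly^2^2))"
  "u_hat = in_degree 2 (trace (generic_y ** generic_y :: 'a coord_poly^2^2))"
  "v_hat = in_degree 2 (trace (generic_x ** generic_y :: 'a coord_poly^2^2))"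
proof -
  have mult: "in_degree 1 p * in_degree 1 q = in_degree 2 (p * q)" for p q :: "'a coord_poly"
    by (simp add: in_degree_def power2_eq_square algebra_simps flip: fps_const_mult)
  have add: "in_degree n (p + q) = in_degree n p + in_degree n q" for n and p q :: "'a coord_poly"
    by (simp add: in_degree_def algebra_simps flip: fps_const_add)
  show "t_hat = in_degree 2 (trace (generic_x ** generic_x :: 'a coord_poly^2^2))"
    and "u_hat = in_degree 2 (trace (generic_y ** generic_y :: 'a coord_poly^2^2))"
    and "v_hat = in_degree 2 (trace (generic_x ** generic_y :: 'a coord_poly^2^2))"
    by (simp_all only: t_hat_def u_hat_def v_hat_def trace_def sum_2 matrix_matrix_mult_def
        x_hat_def y_hat_def vec_lambda_beta mult add)
qed

lemma traces_in_K_tuv: "t_hat \<in> K_tuv" "u_hat \<in> K_tuv" "v_hat \<in> K_tuv"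
  using trace_monomial_in_component[of 1 0 0 2 1] trace_monomial_in_component[of 0 1 0 2 1]
    trace_monomial_in_component[of 0 0 1 2 1]
  by (auto simp: trace_hat trace_monomial_def Const_1 intro!: in_degree_in_K_tuv)

lemma X_dvd_traces: "fps_X dvd t_hat" "fps_X dvd u_hat" "fps_X dvd v_hat"
  by (auto simp: trace_hat in_degree_def power2_eq_square mult.assoc)

section \<open>Series convergent in the formal power series topology\<close>

lemma X_power_dvd_iff: "fps_X ^ m dvd f \<longleftrightarrow> (\<forall>n<m. fps_nth f n = 0)"
  for f :: "'a::comm_ring_1 fps"
proof
  assume "\<forall>n<m. fps_nth f n = 0"
  then have "f = fps_X ^ m * fps_shift m f"
    by (auto simp: fps_eq_iff fps_X_power_mult_nth)
  then show "fps_X ^ m dvd f" by (rule dvdI)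
qed (auto simp: fps_X_power_mult_nth elim!: dvdE)

lemma X_power_dvd_diff_nth:
  "fps_X ^ Suc n dvd f - h \<Longrightarrow> fps_nth f n = fps_nth h n" for f h :: "'a::comm_ring_1 fps"
  by (simp add: X_power_dvd_iff del: power_Suc)

text \<open>Terms from the \<open>m\<close>-th on do not contribute below degree \<open>m\<close>, so the coefficients of the
  partial sums become stationary.  Divisibility expresses this in a form that survives
  multiplication by further series.\<close>

lemma X_adic_suminf_remainder:
  fixes f :: "nat \<Rightarrow> 'a::comm_ring_1 fps"
  assumes "\<And>k. fps_X ^ k dvd f k"
  shows "fps_X ^ m dvd suminf f - (\<Sum>k<m. f k)"
proof -
  define s where "s = Abs_fps (\<lambda>n. fps_nth (\<Sum>k<Suc n. f k) n)"
  have stable: "fps_nth (\<Sum>k<m. f k) n = fps_nth s n" if "n < m" for m n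
  proof -
    have "fps_nth (\<Sum>k<m. f k) n = (\<Sum>k<m. fps_nth (f k) n)"
      by (simp add: fps_sum_nth)
    also have "\<dots> = (\<Sum>k<Suc n. fps_nth (f k) n)"
      by (rule sum.mono_neutral_right) (use that assms in \<open>auto simp: X_power_dvd_iff\<close>)
    finally show ?thesis by (simp add: s_def fps_sum_nth)
  qed
  have "f sums s"
    unfolding sums_def
    by (rule tendsto_fpsI) (auto intro: eventually_mono[OF eventually_gt_at_top] stable)
  then have "suminf f = s" by (simp add: sums_iff)
  then show ?thesis by (simp add: X_power_dvd_iff stable)
qed

lemma K_tuv_suminf:
  assumes "\<And>k. fps_X ^ k dvd f k" and "\<And>k. f k \<in> K_tuv"
  shows "suminf f \<in> K_tuv"
  unfolding K_tuv_iff
proof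
  fix n
  have "fps_nth (suminf f) n = fps_nth (\<Sum>k<Suc n. f k) n"
    by (intro X_power_dvd_diff_nth X_adic_suminf_remainder assms(1))
  then show "fps_nth (suminf f) n \<in> tuv_component n"
    using K_tuv_sum[of "{..<Suc n}" f] assms(2) by (simp add: K_tuv_iff)
qed

lemma X_power_dvd_scaled_power:
  "fps_X dvd w \<Longrightarrow> fps_X ^ k dvd scal c * w ^ k"
  by (simp add: dvd_mult dvd_power_same)

lemma sinh_series_in_K_tuv:
  "fps_X dvd w \<Longrightarrow> w \<in> K_tuv \<Longrightarrow> sinh_series w \<in> K_tuv"
  unfolding sinh_series_def
  by (intro K_tuv_suminf X_power_dvd_scaled_power K_tuv_mult scal_in_K_tuv K_tuv_power)

lemma cosh_series_in_K_tuv: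
  "fps_X dvd w \<Longrightarrow> w \<in> K_tuv \<Longrightarrow> cosh_series w \<in> K_tuv"
  unfolding cosh_series_def
  by (intro K_tuv_suminf X_power_dvd_scaled_power K_tuv_mult scal_in_K_tuv K_tuv_power)

text \<open>The parity splitting of the exponential series, for one matrix entry: \<open>z\<close>, \<open>p\<close>, \<open>q\<close> stand for
  the entries of a matrix and of its first two images under \<open>ad X\<close>.\<close>

lemma exponential_series_split:
  fixes w z p q :: "'k::field_char_0 coord_series"
  assumes w: "fps_X dvd w"
    and e0: "e 0 = z"
    and e_odd: "\<And>k. e (2 * k + 1) = scal (1 / fact (2 * k + 1)) * w ^ k * p"
    and e_even: "\<And>k. e (2 * k + 2) = scal (1 / fact (2 * k + 2)) * w ^ k * q"
  shows "e sums (z + sinh_series w * p + cosh_series w * q)"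
proof -
  define A B where "A N = (\<Sum>k<N. scal (1 / fact (2 * k + 1)) * w ^ k)"
    and "B N = (\<Sum>k<N. scal (1 / fact (2 * k + 2)) * w ^ k)" for N
  \<comment> \<open>Among the indices \<open>n < N\<close> there are \<open>N div 2\<close> odd ones, and \<open>(N - 1) div 2\<close> even ones
    besides \<open>0\<close>.\<close>
  have partial: "(\<Sum>n<N. e n) = z + A (N div 2) * p + B ((N - 1) div 2) * q" if "N > 0" for N
    using that
  proof (induction N)
    case (Suc N)
    consider "N = 0" | k where "N = 2 * k + 1" | k where "N = 2 * k + 2"
      by (metis evenE oddE not0_implies_Suc mult_Suc_right add_2_eq_Suc' add.commute mult_0_right)
    then show ?case
    proof cases
      case 1
      then show ?thesis by (simp add: e0 A_def B_def)
    next
      case 2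
      then show ?thesis using Suc.IH e_odd[of k] by (simp add: A_def algebra_simps)
    next
      case 3
      then show ?thesis using Suc.IH e_even[of k] by (simp add: B_def algebra_simps)
    qed
  qed simp
  have A: "fps_X ^ m dvd sinh_series w - A m" and B: "fps_X ^ m dvd cosh_series w - B m" for m
    unfolding sinh_series_def cosh_series_def A_def B_def
    by (intro X_adic_suminf_remainder X_power_dvd_scaled_power w)+
  \<comment> \<open>From \<open>N = 2 m + 3\<close> on, both \<open>A\<close> and \<open>B\<close> contain more than \<open>m\<close> terms, hence are exact in
    degree \<open>m\<close>.\<close>
  have "fps_nth (\<Sum>n<N. e n) m = fps_nth (z + sinh_series w * p + cosh_series w * q) m"
    if N: "N \<ge> 2 * m + 3" for m N
  proof -
    have "fps_X ^ Suc m dvd sinh_series w - A (N div 2)"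
      by (rule dvd_trans[OF le_imp_power_dvd A]) (use N in auto)
    moreover have "fps_X ^ Suc m dvd cosh_series w - B ((N - 1) div 2)"
      by (rule dvd_trans[OF le_imp_power_dvd B]) (use N in auto)
    ultimately have "fps_X ^ Suc m dvd
        (sinh_series w - A (N div 2)) * p + (cosh_series w - B ((N - 1) div 2)) * q"
      by (intro dvd_add dvd_mult2)
    also have "\<dots> = (z + sinh_series w * p + cosh_series w * q) - (\<Sum>n<N. e n)"
      using N by (subst partial) (auto simp: algebra_simps)
    finally show ?thesis by (rule X_power_dvd_diff_nth[symmetric])
  qed
  then show ?thesis
    unfolding sums_def by (intro tendsto_fpsI) (auto simp: eventually_sequentially)
qed

section \<open>The adjoint action of a traceless matrix\<close>

lemma scalar_times_nth: "(p \<odot> A) $ i $ j = p * A $ i $ j"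
  by (simp add: matrix_matrix_mult_def mat_def if_distrib[of "\<lambda>x. x * _"] cong: if_cong)

lemma mult_scalar_times: "A ** (p \<odot> B) = p \<odot> (A ** B)"
  for p :: "'r::comm_ring_1" and A B :: "'r^'n^'n"
proof -
  have nth: "(A ** C) $ i $ j = (\<Sum>k\<in>UNIV. A $ i $ k * C $ k $ j)" for C :: "'r^'n^'n" and i j
    by (simp add: matrix_matrix_mult_def)
  show ?thesis
    by (simp add: vec_eq_iff scalar_times_nth nth[of "p \<odot> B"] nth[of B] sum_distrib_left mult.left_commute)
qed

lemma scalar_times_diff: "p \<odot> (A - B) = p \<odot> A - p \<odot> B" for p :: "'r::comm_ring_1"
  by (simp add: vec_eq_iff scalar_times_nth algebra_simps)

lemma matrix_add_rdistrib: "(A + B) ** C = A ** C + B ** C"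
  by (simp add: vec_eq_iff matrix_matrix_mult_def sum.distrib algebra_simps)

lemma commutator_scalar_times:
  fixes p :: "'r::comm_ring_1"
  shows "commutator (p \<odot> A) B = p \<odot> commutator A B"
    and "commutator A (p \<odot> B) = p \<odot> commutator A B"
  by (simp_all add: commutator_def mult_scalar_times scalar_times_diff flip: matrix_mul_assoc)

lemma commutator_add:
  "commutator (A + B) C = commutator A C + commutator B C"
  "commutator C (A + B) = commutator C A + commutator C B"
  by (simp_all add: commutator_def matrix_add_ldistrib matrix_add_rdistrib)

text \<open>The heart of the matter: \<open>2 X\<^sup>2\<close> is the scalar \<open>trace (X\<^sup>2)\<close>, which makes the triple commutator
  collapse.  The identity involves no denominators and is checked on entries.\<close>

lemma ad_cubed:
  assumes "trace X = 0"
  shows "ad X (ad X (ad X z)) = (2 * trace (X ** X)) \<odot> ad X z"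
proof -
  have X: "X $ 2 $ 2 = - X $ 1 $ 1"
    using assms by (simp add: trace_def sum_2 eq_neg_iff_add_eq_0 add.commute)
  show ?thesis
    unfolding vec_eq_iff forall_2 scalar_times_nth
    by (simp add: ad_def commutator_def matrix_matrix_mult_def sum_2 trace_def X algebra_simps)
qed

text \<open>Conceptually, \<open>[P, [P, Q]] = P\<^sup>2 Q - 2 P Q P + Q P\<^sup>2\<close>, where \<open>2 P\<^sup>2 = tr(P\<^sup>2)\<close> and
  \<open>P Q + Q P = tr(P Q)\<close> are scalars.\<close>

lemma commutator_commutator:
  fixes P Q :: "'r::comm_ring_1^2^2"
  assumes "trace P = 0" "trace Q = 0"
  shows "commutator P (commutator P Q) = (2 * trace (P ** P)) \<odot> Q - (2 * trace (P ** Q)) \<odot> P"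
proof -
  have "P $ 2 $ 2 = - P $ 1 $ 1" "Q $ 2 $ 2 = - Q $ 1 $ 1"
    using assms by (simp_all add: trace_def sum_2 eq_neg_iff_add_eq_0 add.commute)
  then show ?thesis
    unfolding vec_eq_iff forall_2 vector_minus_component scalar_times_nth
    by (simp add: commutator_def matrix_matrix_mult_def sum_2 trace_def algebra_simps)
qed

lemma trace_x_hat: "trace x_hat = 0" and trace_y_hat: "trace y_hat = 0"
  by (simp_all add: trace_def sum_2 x_hat_def y_hat_def generic_x_def generic_y_def in_degree_def flip: fps_const_neg)

text \<open>The trace form on traceless matrices, in the coordinates with respect to \<open>P\<close>, \<open>Q\<close>, \<open>[P, Q]\<close>:
  the commutator is orthogonal to \<open>P\<close> and \<open>Q\<close>, and its square has trace
  \<open>2 (tr(P Q)\<^sup>2 - tr(P\<^sup>2) tr(Q\<^sup>2))\<close>.\<close>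

lemma trace_combination_squared:
  fixes P Q :: "'r::comm_ring_1^2^2" and a b c :: 'r
  assumes "trace P = 0" "trace Q = 0"
  defines "Z \<equiv> a \<odot> P + b \<odot> Q + c \<odot> commutator P Q"
  shows "trace Z = 0"
    and "trace (Z ** Z) = a\<^sup>2 * trace (P ** P) + 2 * a * b * trace (P ** Q) + b\<^sup>2 * trace (Q ** Q)
      + 2 * c\<^sup>2 * ((trace (P ** Q))\<^sup>2 - trace (P ** P) * trace (Q ** Q))"
proof -
  have PQ: "P $ 2 $ 2 = - P $ 1 $ 1" "Q $ 2 $ 2 = - Q $ 1 $ 1"
    using assms by (simp_all add: trace_def sum_2 eq_neg_iff_add_eq_0 add.commute)
  have Z: "Z $ i $ j = a * P $ i $ j + b * Q $ i $ j + c * commutator P Q $ i $ j" for i j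
    by (simp add: Z_def scalar_times_nth)
  show "trace Z = 0"
    by (simp add: trace_def sum_2 Z commutator_def matrix_matrix_mult_def PQ algebra_simps)
  show "trace (Z ** Z) = a\<^sup>2 * trace (P ** P) + 2 * a * b * trace (P ** Q) + b\<^sup>2 * trace (Q ** Q)
      + 2 * c\<^sup>2 * ((trace (P ** Q))\<^sup>2 - trace (P ** P) * trace (Q ** Q))"
    by (simp add: trace_def sum_2 matrix_matrix_mult_def Z commutator_def PQ power2_eq_square algebra_simps)
qed

text \<open>Iterating the cubic relation makes every odd power of \<open>ad X\<close> a multiple of \<open>ad X\<close> and every
  positive even power a multiple of \<open>(ad X)\<^sup>2\<close>, so that each entry falls under
  \<open>exponential_series_split\<close>.\<close>

lemma exp_ad_eq:
  fixes X z :: "'k::field_char_0 coord_series^2^2"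
  assumes cube: "\<And>z. ad X (ad X (ad X z)) = w \<odot> ad X z" and w: "fps_X dvd w"
  shows "exp_ad X z = z + sinh_series w \<odot> ad X z + cosh_series w \<odot> ad X (ad X z)"
proof -
  have odd: "(ad X ^^ (2 * k + 1)) z = w ^ k \<odot> ad X z" for k
  proof (induction k)
    case (Suc k)
    have "(ad X ^^ (2 * Suc k + 1)) z = ad X (ad X ((ad X ^^ (2 * k + 1)) z))" by simp
    also have "\<dots> = w ^ Suc k \<odot> ad X z"
      unfolding Suc.IH ad_def commutator_scalar_times cube[unfolded ad_def]
      by (simp add: vec_eq_iff scalar_times_nth algebra_simps)
    finally show ?case .
  qed simp
  have even: "(ad X ^^ (2 * k + 2)) z = w ^ k \<odot> ad X (ad X z)" for k
    using odd[of k] by (simp add: ad_def commutator_scalar_times)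
  have "(\<lambda>n. scal (1 / fact n) \<odot> (ad X ^^ n) z) sums
      (z + sinh_series w \<odot> ad X z + cosh_series w \<odot> ad X (ad X z))"
    unfolding sums_def
  proof (intro vec_tendstoI)
    fix i j
    let ?e = "\<lambda>n. scal (1 / fact n) * (ad X ^^ n) z $ i $ j"
    have "?e sums (z $ i $ j + sinh_series w * ad X z $ i $ j + cosh_series w * ad X (ad X z) $ i $ j)"
    proof (rule exponential_series_split[OF w])
      show "?e 0 = z $ i $ j" by (simp add: scal_1)
    next
      fix k
      show "?e (2 * k + 1) = scal (1 / fact (2 * k + 1)) * w ^ k * ad X z $ i $ j"
        unfolding odd scalar_times_nth mult.assoc ..
      show "?e (2 * k + 2) = scal (1 / fact (2 * k + 2)) * w ^ k * ad X (ad X z) $ i $ j"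
        unfolding even scalar_times_nth mult.assoc ..
    qed
    then show "(\<lambda>N. (\<Sum>n<N. scal (1 / fact n) \<odot> (ad X ^^ n) z) $ i $ j) \<longlonglongrightarrow>
        (z + sinh_series w \<odot> ad X z + cosh_series w \<odot> ad X (ad X z)) $ i $ j"
      unfolding sums_def by (simp add: sum_component scalar_times_nth)
  qed
  then show ?thesis unfolding exp_ad_def by (simp add: sums_iff)
qed

section \<open>Calculus of associated matrices\<close>

lemma combination_lincomb:
  "p \<odot> combination p1 q1 r1 + q \<odot> combination p2 q2 r2 + r \<odot> combination p3 q3 r3
    = combination (p1 * p + p2 * q + p3 * r) (q1 * p + q2 * q + q3 * r) (r1 * p + r2 * q + r3 * r)"
  by (simp add: vec_eq_iff combination_def scalar_times_nth algebra_simps)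

lemma has_associated_matrix_id: "has_associated_matrix (\<lambda>z. z) (mat 1)"
proof -
  have nth: "(mat 1 :: 'a coord_series^3^3) $ i $ j = (if i = j then 1 else 0)" for i j
    by (simp add: mat_def)
  show ?thesis
    by (simp add: has_associated_matrix_def nth K_tuv_0 K_tuv_1 combination_def vec_eq_iff scalar_times_nth)
qed

lemma has_associated_matrix_add:
  assumes "has_associated_matrix \<delta> \<sigma>" "has_associated_matrix \<epsilon> \<tau>"
  shows "has_associated_matrix (\<lambda>z. \<delta> z + \<epsilon> z) (\<sigma> + \<tau>)"
  using assms
  by (simp add: has_associated_matrix_def K_tuv_add combination_def vec_eq_iff scalar_times_nth algebra_simps)

lemma has_associated_matrix_scale:
  assumes "p \<in> K_tuv" "has_associated_matrix \<delta> \<sigma>"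
  shows "has_associated_matrix (\<lambda>z. p \<odot> \<delta> z) (p \<odot> \<sigma>)"
  using assms
  by (simp add: has_associated_matrix_def K_tuv_mult combination_def vec_eq_iff scalar_times_nth algebra_simps)

text \<open>The inner map sends a basis element to a combination with coefficients from a column of \<open>\<tau>\<close>;
  linearity of the outer map turns it into the same combination of the columns of \<open>\<sigma>\<close>.\<close>

lemma has_associated_matrix_compose:
  assumes \<delta>: "has_associated_matrix \<delta> \<sigma>" and \<epsilon>: "has_associated_matrix \<epsilon> \<tau>"
    and linear: "\<And>p q r. \<delta> (combination p q r)
      = p \<odot> \<delta> x_hat + q \<odot> \<delta> y_hat + r \<odot> \<delta> (commutator x_hat y_hat)"
  shows "has_associated_matrix (\<lambda>z. \<delta> (\<epsilon> z)) (\<sigma> ** \<tau>)"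
proof -
  have "(\<sigma> ** \<tau>) $ i $ j \<in> K_tuv" for i j
    using \<delta> \<epsilon> unfolding has_associated_matrix_def matrix_matrix_mult_def
    by (simp add: K_tuv_sum K_tuv_mult)
  then show ?thesis
    using \<delta> \<epsilon> unfolding has_associated_matrix_def
    by (simp add: linear combination_lincomb) (simp add: matrix_matrix_mult_def sum_3)
qed

section \<open>The exponential of the adjoint action\<close>

theorem theorem5:
  fixes a b c g :: "'k::field_char_0 coord_series"
    and X :: "'k coord_series^2^2"
    and M :: "'k coord_series^3^3"
  assumes "a \<in> K_tuv" and "b \<in> K_tuv" and "c \<in> K_tuv"
    and "X = a \<odot> x_hat + b \<odot> y_hat + c \<odot> commutator x_hat y_hat"
    and "X \<in> W_hat"
    and "M = vector
      [vector [- 2 * c * v_hat, - 2 * c * u_hat,   2 * (a * v_hat + b * u_hat)],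
       vector [  2 * c * t_hat,   2 * c * v_hat, - 2 * (a * t_hat + b * v_hat)],
       vector [              b,             - a,                             0]]"
    and "g = 2 * (a\<^sup>2 * t_hat + 2 * a * b * v_hat + b\<^sup>2 * u_hat
                  + 2 * c\<^sup>2 * (v_hat\<^sup>2 - t_hat * u_hat))"
  shows "has_associated_matrix (ad X) M \<and>
         has_associated_matrix (exp_ad X)
           (mat 1 + sinh_series g \<odot> M + cosh_series g \<odot> (M ** M))"
proof -
  let ?C = "commutator x_hat y_hat :: 'k coord_series^2^2"
  note X = assms(4) and M = assms(6) and g = assms(7)
  note abc = assms(1-3)
  note tuv = t_hat_def[symmetric] u_hat_def[symmetric] v_hat_def[symmetric]
  have vu: "trace (y_hat ** x_hat) = (v_hat :: 'k coord_series)"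
    unfolding v_hat_def by (rule trace_mul_sym)
  have swap: "commutator P Q = - commutator Q P" for P Q :: "'k coord_series^2^2"
    by (simp add: commutator_def)
  have comm_neg: "commutator P (- Q) = - commutator P Q" for P Q :: "'k coord_series^2^2"
    by (simp add: commutator_def vec_eq_iff matrix_matrix_mult_def sum_2)
  have ad_X: "ad X z = a \<odot> commutator z x_hat + b \<odot> commutator z y_hat + c \<odot> commutator z ?C" for z
    by (simp add: X ad_def commutator_add commutator_scalar_times)
  have self: "commutator z z = 0" for z :: "'k coord_series^2^2"
    by (simp add: commutator_def)
  \<comment> \<open>Up to sign, these and \<open>[x, y]\<close> are the only nonzero brackets of basis elements.\<close>
  have xC: "commutator x_hat ?C = (2 * t_hat) \<odot> y_hat - (2 * v_hat) \<odot> x_hat"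
    using commutator_commutator[OF trace_x_hat trace_y_hat] by (simp add: tuv)
  have yC: "commutator y_hat ?C = (2 * v_hat) \<odot> y_hat - (2 * u_hat) \<odot> x_hat"
    using commutator_commutator[of "y_hat :: 'k coord_series^2^2" x_hat, OF trace_y_hat trace_x_hat]
    by (simp add: swap[of x_hat y_hat] comm_neg tuv vu)
  have Mnth: "\<forall>i j. M $ i $ j \<in> K_tuv"
    unfolding forall_3 M using abc
    by (simp add: K_tuv_add K_tuv_diff K_tuv_mult K_tuv_uminus K_tuv_2 K_tuv_0 traces_in_K_tuv)
  have adM: "has_associated_matrix (ad X) M"
    unfolding has_associated_matrix_def
  proof (intro conjI)
    show "\<forall>i j. M $ i $ j \<in> K_tuv" by (rule Mnth)
    show "ad X x_hat = combination (M $ 1 $ 1) (M $ 2 $ 1) (M $ 3 $ 1)"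
      unfolding ad_X self xC M
      by (simp add: vec_eq_iff combination_def scalar_times_nth algebra_simps)
    show "ad X y_hat = combination (M $ 1 $ 2) (M $ 2 $ 2) (M $ 3 $ 2)"
      unfolding ad_X self yC M swap[of y_hat x_hat]
      by (simp add: vec_eq_iff combination_def scalar_times_nth algebra_simps)
    show "ad X ?C = combination (M $ 1 $ 3) (M $ 2 $ 3) (M $ 3 $ 3)"
      unfolding ad_X self swap[of ?C x_hat] swap[of ?C y_hat] xC yC M
      by (simp add: vec_eq_iff combination_def scalar_times_nth algebra_simps)
  qed
  have g_trace: "g = 2 * trace (X ** X)" and trX: "trace X = 0"
    unfolding g X tuv[symmetric]
    by (simp_all add: trace_combination_squared[OF trace_x_hat trace_y_hat])
  have cube: "ad X (ad X (ad X z)) = g \<odot> ad X z" for z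
    unfolding g_trace by (rule ad_cubed[OF trX])
  \<comment> \<open>Although \<open>a\<close>, \<open>b\<close>, \<open>c\<close> may have constant terms, each summand of \<open>g\<close> contains a trace.\<close>
  have Xg: "fps_X dvd g"
    unfolding g power2_eq_square[of v_hat] by (intro dvd_mult dvd_add dvd_diff dvd_mult2 X_dvd_traces)
  have gK: "g \<in> K_tuv"
    unfolding g by (intro K_tuv_mult K_tuv_add K_tuv_diff K_tuv_power K_tuv_2 traces_in_K_tuv abc)
  have "exp_ad X = (\<lambda>z. (z + sinh_series g \<odot> ad X z) + cosh_series g \<odot> ad X (ad X z))"
    using exp_ad_eq[OF cube Xg] by blast
  moreover have "has_associated_matrix \<dots> (mat 1 + sinh_series g \<odot> M + cosh_series g \<odot> (M ** M))"
    by (intro has_associated_matrix_add has_associated_matrix_id has_associated_matrix_scale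
        has_associated_matrix_compose adM sinh_series_in_K_tuv cosh_series_in_K_tuv Xg gK)
      (simp add: combination_def ad_def commutator_add commutator_scalar_times)
  ultimately show ?thesis using adM by simp
qed

end
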